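(* Let $q$ be a power of an odd prime, let $d\ge 1$ be an integer, let $\mathcal{E}, \mathcal{F} \subset \mathbb{F}_q \times \mathbb{F}_q^d$, and let $B(\cdot,\cdot)$ be any non-degenerate bilinear form on $\mathbb{F}_q^d$. Suppose that $|\mathcal{E}||\mathcal{F}| \ge 2q^{d+2}$. Then for every $\lambda \in \mathbb{F}_q$ the equation $$a + c + \lambda = B(\boldsymbol{b}, \boldsymbol{d}), \qquad (a,\boldsymbol{b}) \in \mathcal{E},\ (c,\boldsymbol{d}) \in \mathcal{F},$$ is solvable.
   Context: $\mathbb{F}_q$ is the finite field with $q$ elements; elements of $\mathbb{F}_q\times\mathbb{F}_q^d$ are written as pairs $(a,\boldsymbol{b})$ with $a\in\mathbb{F}_q$ and $\boldsymbol{b}\in\mathbb{F}_q^d$. *)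

theory Defs
  imports "HOL-Analysis.Analysis" "HOL-Computational_Algebra.Primes"
begin

text \<open>
  The distribution's \<open>bilinear\<close> and \<open>bounded_bilinear\<close> are restricted to real scalars. Over an
  arbitrary field, the form takes values in the field seen as a vector space over itself,
  i.e. with scalar multiplication \<open>(*)\<close>. Symmetry is not required.
\<close>

definition bilinear_form :: "('a::field ^ 'n \<Rightarrow> 'a ^ 'n \<Rightarrow> 'a) \<Rightarrow> bool" where
  "bilinear_form B \<longleftrightarrow>
     (\<forall>x. Vector_Spaces.linear (*s) (*) (\<lambda>y. B x y)) \<and>
     (\<forall>y. Vector_Spaces.linear (*s) (*) (\<lambda>x. B x y))"

definition nondegenerate :: "('a::field ^ 'n \<Rightarrow> 'a ^ 'n \<Rightarrow> 'a) \<Rightarrow> bool" where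
  "nondegenerate B \<longleftrightarrow>
     (\<forall>x. (\<forall>y. B x y = 0) \<longrightarrow> x = 0) \<and>
     (\<forall>y. (\<forall>x. B x y = 0) \<longrightarrow> y = 0)"

end

theory Submission
  imports Defs
begin

text \<open>
  Fix \<open>l\<close>. Each \<open>(c, e)\<close> in \<open>F\<close> determines the graph \<open>a = B b e - c - l\<close>, a set of \<open>q^d\<close> points of
  \<open>F_q \<times> F_q^d\<close>, and the equation has no solution exactly when \<open>E\<close> avoids all of these graphs.
  Non-degeneracy makes distinct graphs almost independent: two of them with the same \<open>e\<close> are
  disjoint, and two with different \<open>e\<close> meet where the non-zero functional \<open>\<lambda>b. B b (e - e')\<close> takes a
  prescribed value, which happens at \<open>q^(d-1)\<close> points (\<open>card_level_set\<close>). That is the proportion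
  expected of independent random sets of density \<open>1/q\<close>. A second moment argument
  (\<open>card_avoiding_set_le\<close>) then shows that few points lie on none of the graphs:
  \<open>|E| (|F| + q) \<le> q^(d+2)\<close>. This contradicts the hypothesis on \<open>|E| |F|\<close>.
\<close>

text \<open>
  All fibres of a non-zero functional are translates of its kernel, so they split the space into
  parts of equal size.
\<close>

lemma card_level_set:
  fixes f :: "'a::{field,finite} ^ 'n \<Rightarrow> 'a"
  assumes lin: "Vector_Spaces.linear (*s) (*) f" and nz: "f z \<noteq> 0"
  shows "CARD('a) * card {x. f x = t} = CARD('a) ^ CARD('n)"
proof -
  interpret f: Vector_Spaces.linear "(*s)" "(*)" f by (fact lin)
  define u where "u = inverse (f z) *s z"
  have u: "f u = 1"
    using nz by (simp add: u_def f.scale)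
  have fibre: "card {x. f x = s} = card {x. f x = t}" for s
  proof (rule bij_betw_same_card)
    show "bij_betw (\<lambda>x. x + (t - s) *s u) {x. f x = s} {x. f x = t}"
      by (rule bij_betw_byWitness[where f' = "\<lambda>x. x - (t - s) *s u"])
         (auto simp: f.add f.diff f.scale u)
  qed
  have "(\<Union>s. {x. f x = s}) = UNIV"
    by auto
  then have "CARD('a) ^ CARD('n) = card (\<Union>s. {x. f x = s})"
    by simp
  also have "\<dots> = (\<Sum>s\<in>UNIV. card {x. f x = s})"
    by (rule card_UN_disjoint) auto
  also have "\<dots> = CARD('a) * card {x. f x = t}"
    by (subst sum.cong[OF refl fibre]) simp_all
  finally show ?thesis by simp
qed

text \<open>
  Second moment method. Let \<open>N x\<close> be the number of \<open>y \<in> F\<close> incident to \<open>x\<close>. The hypotheses determine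
  the sum of \<open>N\<close> and bound the sum of \<open>N\<^sup>2\<close> nearly by what a constant \<open>N\<close> would give. Since \<open>N\<close>
  vanishes on \<open>E\<close>, all of its mass sits on the complement of \<open>E\<close>, where Cauchy-Schwarz makes the sum
  of \<open>N\<^sup>2\<close> large if the complement is small.
\<close>

lemma card_avoiding_set_le:
  fixes inc :: "'x::finite \<Rightarrow> 'y \<Rightarrow> bool" and E :: "'x set" and F :: "'y set"
  assumes fin: "finite F"
    and card_X: "CARD('x) = q * m"
    and single: "\<And>y. y \<in> F \<Longrightarrow> card {x. inc x y} = m"
    and pairs: "\<And>y y'. y \<in> F \<Longrightarrow> y' \<in> F \<Longrightarrow> y \<noteq> y' \<Longrightarrow> q * card {x. inc x y \<and> inc x y'} \<le> m"
    and avoid: "\<And>x y. x \<in> E \<Longrightarrow> y \<in> F \<Longrightarrow> \<not> inc x y"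
  shows "card E * (card F + q) \<le> q\<^sup>2 * m"
proof (cases "F = {}")
  case True
  have "card E \<le> q * m"
    using card_mono[of UNIV E] card_X by simp
  then show ?thesis
    using True by (simp add: power2_eq_square algebra_simps)
next
  case False
  define N where "N x = (\<Sum>y\<in>F. of_bool (inc x y) :: real)" for x
  have card_as_sum: "real (card {x. P x}) = (\<Sum>x\<in>UNIV. of_bool (P x))" for P :: "'x \<Rightarrow> bool"
    by simp
  have "0 < card (UNIV :: 'x set)"
    by (simp add: card_gt_0_iff)
  then have pos: "0 < q" "0 < m"
    using card_X by auto
  have cF: "0 < card F"
    using False fin by (simp add: card_gt_0_iff)
  have N0: "N x = 0" if "x \<in> E" for x
    using avoid that by (auto simp: N_def)
  have "(\<Sum>x\<in>UNIV. N x) = (\<Sum>y\<in>F. real (card {x. inc x y}))"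
    unfolding N_def card_as_sum by (rule sum.swap)
  also have "\<dots> = real (card F * m)"
    by (simp add: single)
  finally have first: "(\<Sum>x\<in>UNIV. N x) = real (card F * m)" .
  have "(\<Sum>x\<in>UNIV. (N x)\<^sup>2) = (\<Sum>x\<in>UNIV. \<Sum>y\<in>F. \<Sum>y'\<in>F. of_bool (inc x y \<and> inc x y'))"
    by (simp add: N_def power2_eq_square sum_product of_bool_conj)
  also have "\<dots> = (\<Sum>y\<in>F. \<Sum>y'\<in>F. real (card {x. inc x y \<and> inc x y'}))"
    unfolding card_as_sum by (subst sum.swap) (intro sum.cong refl sum.swap)
  finally have "q * (\<Sum>x\<in>UNIV. (N x)\<^sup>2) = (\<Sum>y\<in>F. \<Sum>y'\<in>F. real (q * card {x. inc x y \<and> inc x y'}))"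
    by (simp add: sum_distrib_left)
  also have "\<dots> \<le> (\<Sum>y\<in>F. \<Sum>y'\<in>F. real m + (if y = y' then real (q * m) else 0))"
  proof (intro sum_mono)
    fix y y' assume "y \<in> F" "y' \<in> F"
    then show "real (q * card {x. inc x y \<and> inc x y'}) \<le> real m + (if y = y' then real (q * m) else 0)"
      using pairs[of y y'] single[of y] by (cases "y = y'") (auto simp del: of_nat_mult)
  qed
  also have "\<dots> = real (card F * (card F * m + q * m))"
    using fin by (simp add: sum.distrib algebra_simps)
  finally have second: "q * (\<Sum>x\<in>UNIV. (N x)\<^sup>2) \<le> real (card F * (card F * m + q * m))" .
  have outside: "(\<Sum>x\<in>UNIV. g (N x)) = (\<Sum>x\<in>-E. g (N x))" if "g 0 = 0" for g :: "real \<Rightarrow> real"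
    by (rule sum.mono_neutral_right) (auto simp: N0 that)
  have "card E + card (- E) = CARD('x)"
    by (subst card_Un_disjoint[symmetric]) auto
  then have cE: "real (card (- E)) = real q * m - card E"
    unfolding card_X by (metis add_diff_cancel_left' of_nat_add of_nat_mult)
  have cs: "(real (card F * m))\<^sup>2 \<le> (\<Sum>x\<in>UNIV. (N x)\<^sup>2) * (real q * m - card E)"
    using sum_squared_le_sum_of_squares[of N "- E"] first outside[of "\<lambda>t. t"] outside[of "\<lambda>t. t\<^sup>2"] cE
    by simp
  have "q * (real (card F * m))\<^sup>2 \<le> (q * (\<Sum>x\<in>UNIV. (N x)\<^sup>2)) * (real q * m - card E)"
    using mult_left_mono[OF cs, of q] by (simp add: mult.assoc)
  also have "\<dots> \<le> real (card F * (card F * m + q * m)) * (real q * m - card E)"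
    using second cE by (intro mult_right_mono) (simp_all flip: cE)
  finally have "(real (card F) * m) * (real q * (card F * m))
      \<le> (real (card F) * m) * ((card F + q) * (real q * m - card E))"
    by (simp add: power2_eq_square algebra_simps)
  then have "real q * (card F * m) \<le> (card F + q) * (real q * m - card E)"
    using cF pos by (simp add: mult_le_cancel_left_pos)
  then have "real (card E * (card F + q)) \<le> real (q\<^sup>2 * m)"
    by (simp add: power2_eq_square algebra_simps)
  then show ?thesis
    by (simp only: of_nat_le_iff)
qed

lemma card_graph:
  "card {x :: 'a::{field,finite} \<times> 'b::finite. fst x + c + l = g (snd x)} = CARD('b)"
proof -
  have "{x :: 'a \<times> 'b. fst x + c + l = g (snd x)} = (\<lambda>b. (g b - c - l, b)) ` UNIV"
    by (auto simp: image_iff algebra_simps)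
  then show ?thesis
    by (simp add: card_image inj_on_def)
qed

text \<open>
  A common point of the graphs of \<open>(c, e)\<close> and \<open>(c', e')\<close> is determined by its component \<open>b\<close>, which
  must satisfy \<open>B b (e - e') = c - c'\<close>.
\<close>

lemma card_graph_inter_le:
  fixes B :: "'a::{field,finite} ^ 'n \<Rightarrow> 'a ^ 'n \<Rightarrow> 'a"
  assumes bil: "bilinear_form B" and nondeg: "nondegenerate B"
    and ne: "(c, e) \<noteq> (c', e')"
  shows "CARD('a) * card {x. fst x + c + l = B (snd x) e \<and> fst x + c' + l = B (snd x) e'}
    \<le> CARD('a) ^ CARD('n)" (is "_ * card ?S \<le> _")
proof -
  have lin_left: "Vector_Spaces.linear (*s) (*) (\<lambda>b. B b w)" for w
    using bil by (simp add: bilinear_form_def)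
  have lin_right: "Vector_Spaces.linear (*s) (*) (B b)" for b
    using bil by (simp add: bilinear_form_def)
  have B_diff: "B b (e - e') = B b e - B b e'" for b
  proof -
    interpret Vector_Spaces.linear "(*s)" "(*)" "B b" by (fact lin_right)
    show ?thesis by (rule diff)
  qed
  show ?thesis
  proof (cases "e = e'")
    case True
    with ne have "?S = {}"
      by auto (metis add_left_cancel add_right_cancel)
    then show ?thesis by (simp only: card.empty mult_0_right zero_le)
  next
    case False
    then have "e - e' \<noteq> 0" by simp
    then obtain z where z: "B z (e - e') \<noteq> 0"
      using nondeg unfolding nondegenerate_def by blast
    have inj: "inj_on snd ?S"
      by (auto simp: inj_on_def) (metis add_right_cancel)
    have diff_eq: "B b e - B b e' = c - c'" if "a + c + l = B b e" "a + c' + l = B b e'" for a b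
      by (simp flip: that)
    have "snd ` ?S \<subseteq> {b. B b (e - e') = c - c'}"
      by (auto simp: B_diff intro: diff_eq)
    then have "card ?S \<le> card {b. B b (e - e') = c - c'}"
      by (rule card_inj_on_le[OF inj]) simp
    then have "CARD('a) * card ?S \<le> CARD('a) * card {b. B b (e - e') = c - c'}"
      by (rule mult_left_mono) simp
    also have "\<dots> = CARD('a) ^ CARD('n)"
      by (rule card_level_set[OF lin_left z])
    finally show ?thesis .
  qed
qed

theorem theorem2p19:
  fixes p k q d :: nat
    and E F :: "('a::{field,finite} \<times> ('a ^ 'n)) set"
    and B :: "'a ^ 'n \<Rightarrow> 'a ^ 'n \<Rightarrow> 'a"
  assumes "prime p" and "odd p" and "k \<ge> 1" and "q = p ^ k"
    and "CARD('a) = q"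
    and "d \<ge> 1" and "CARD('n) = d"
    and "bilinear_form B" and "nondegenerate B"
    and "card E * card F \<ge> 2 * q ^ (d + 2)"
  shows "\<forall>l :: 'a. \<exists>(a, b) \<in> E. \<exists>(c, e) \<in> F. a + c + l = B b e"
proof (rule allI, rule ccontr)
  fix l :: 'a
  assume no_solution: "\<not> (\<exists>(a, b) \<in> E. \<exists>(c, e) \<in> F. a + c + l = B b e)"
  have "card E * (card F + q) \<le> q\<^sup>2 * q ^ d"
  proof (rule card_avoiding_set_le[where inc = "\<lambda>x y. fst x + fst y + l = B (snd x) (snd y)"])
    show "CARD('a \<times> ('a ^ 'n)) = q * q ^ d"
      using assms(5,7) by simp
    show "card {x. fst x + fst y + l = B (snd x) (snd y)} = q ^ d" for y
      using card_graph[of "fst y" l "\<lambda>b. B b (snd y)"] assms(5,7) by simp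
    show "q * card {x. fst x + fst y + l = B (snd x) (snd y) \<and> fst x + fst y' + l = B (snd x) (snd y')}
        \<le> q ^ d" if "y \<noteq> y'" for y y'
      using card_graph_inter_le[OF assms(8,9), of "fst y" "snd y" "fst y'" "snd y'" l] that assms(5,7)
      by (simp add: prod_eq_iff)
  qed (use no_solution in \<open>auto simp: split_beta\<close>)
  then have "card E * card F + card E * q \<le> q ^ (d + 2)"
    by (simp only: power_add mult.commute[of "q\<^sup>2"] distrib_left)
  then have "card E * card F \<le> q ^ (d + 2)"
    by (rule add_leD1)
  moreover have "0 < q ^ (d + 2)"
    using assms(5) by (metis zero_less_card_finite zero_less_power)
  ultimately show False
    using assms(10) by linarith
qed

end
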